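(* Let $n\ge1$, let $V$ be a finite nonempty set, $X=V^n$, $\tau>0$, let $p_{\theta,\tau}(\cdot\mid x_{-i})$ be the temperature-scaled conditionals induced by local scores $s_i$, let $P_\tau$ be the associated single-site Glauber kernel on $X$ and $\mu_\tau$ its unique stationary distribution, as defined in the context. Let $B\subseteq X$ be nonempty and suppose $B$ satisfies the uniform local margin condition (defined in the context) with constant $\Delta_\star>0$. Then for every $x\in B$, $$P_\tau(x,B^c)\le |V|\,e^{-\Delta_\star/\tau}.$$ Consequently the conductance of $B$ satisfies $$\Phi_\tau(B):=\frac{\sum_{x\in B}\mu_\tau(x)P_\tau(x,B^c)}{\mu_\tau(B)}\le |V|\,e^{-\Delta_\star/\tau}.$$ If additionally $\mu_\tau(B)\le\frac12$, then $$t_{\mathrm{mix}}(1/4)\ge\frac{1}{4|V|}\,e^{\Delta_\star/\tau}.$$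
   Context: Setting. $V$ is a finite nonempty vocabulary, $n\ge1$, $X=V^n$, $[n]=\{1,\dots,n\}$. For $x\in X$ and $i\in[n]$, $x_{-i}$ denotes $x$ with the $i$-th coordinate removed, and $x^{(i\to a)}$ denotes $x$ with coordinate $i$ replaced by $a\in V$. For each $i$, each context $x_{-i}$ and each $a\in V$ an arbitrary real number (local score) $s_i(a;x_{-i})$ is given. For $\tau>0$, $$p_{\theta,\tau}(a\mid x_{-i})=\frac{\exp(s_i(a;x_{-i})/\tau)}{\sum_{b\in V}\exp(s_i(b;x_{-i})/\tau)}.$$ The conditionals are not assumed to come from a joint distribution. The Glauber kernel is $$P_\tau(x,x')=\frac1n\sum_{i=1}^n\mathbf 1_{x_{-i}=x'_{-i}}\,p_{\theta,\tau}(x'_i\mid x_{-i}),$$ and $P_\tau(x,A)=\sum_{x'\in A}P_\tau(x,x')$. It is irreducible and aperiodic and so has a unique stationary distribution $\mu_\tau$ (it need not be reversible). For each site $i$ and context $x_{-i}$ fix a choice of score maximizer $m_i(x_{-i})\in\arg\max_{a\in V}s_i(a;x_{-i})$. Uniform local margin condition on $B$ with constant $\Delta_\star>0$: for every $x\in B$ and every site $i$ for which changing $x_i$ can move the state outside $B$ (i.e. there is $a\in V$ with $x^{(i\to a)}\notin B$), one has $x_i=m_i(x_{-i})$ and $$s_i(x_i;x_{-i})-s_i(a;x_{-i})\ge\Delta_\star\quad\text{for all } a\ne x_i \text{ with } x^{(i\to a)}\notin B.$$ Mixing time: $t_{\mathrm{mix}}(\varepsilon)=\min\{t\in\mathbb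 Z_{\ge0}:\max_{x\in X}\|P_\tau^t(x,\cdot)-\mu_\tau\|_{\mathrm{TV}}\le\varepsilon\}$, where $\|\nu-\nu'\|_{\mathrm{TV}}=\frac12\sum_z|\nu(z)-\nu'(z)|$. *)

theory Defs
  imports "HOL-Analysis.Analysis"
begin

text \<open>
  The sites are the elements of a finite type \<open>'n\<close> (so \<open>n = CARD('n)\<close>), the vocabulary is a finite
  type \<open>'v\<close>, and the state space \<open>X\<close> of all configurations is the (finite) type \<open>'n \<Rightarrow> 'v\<close>. The
  configuration with coordinate \<open>i\<close> replaced by \<open>a\<close> is \<open>x(i := a)\<close>.

  A context, i.e. a configuration with one coordinate removed, is a partial configuration that is
  undefined at exactly that site. Scores are functions of the context, so they cannot depend on the
  removed coordinate; their values at other partial maps are never used.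
\<close>

definition remove_site :: "'n \<Rightarrow> ('n \<Rightarrow> 'v) \<Rightarrow> ('n \<rightharpoonup> 'v)" where
  "remove_site i x = (\<lambda>j. if j = i then None else Some (x j))"

type_synonym ('n, 'v) scores = "'n \<Rightarrow> 'v \<Rightarrow> ('n \<rightharpoonup> 'v) \<Rightarrow> real"

definition local_conditional ::
    "('n, 'v::finite) scores \<Rightarrow> real \<Rightarrow> 'n \<Rightarrow> 'v \<Rightarrow> ('n \<rightharpoonup> 'v) \<Rightarrow> real" where
  "local_conditional s \<tau> i a c = exp (s i a c / \<tau>) / (\<Sum>b\<in>UNIV. exp (s i b c / \<tau>))"

definition glauber_kernel ::
    "('n::finite, 'v::finite) scores \<Rightarrow> real \<Rightarrow> ('n \<Rightarrow> 'v) \<Rightarrow> ('n \<Rightarrow> 'v) \<Rightarrow> real" where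
  "glauber_kernel s \<tau> x x' =
     1 / real CARD('n) *
       (\<Sum>i\<in>UNIV. of_bool (remove_site i x = remove_site i x') *
                   local_conditional s \<tau> i (x' i) (remove_site i x))"

definition kernel_prob :: "('x \<Rightarrow> 'x \<Rightarrow> real) \<Rightarrow> 'x \<Rightarrow> 'x set \<Rightarrow> real" where
  "kernel_prob P x A = (\<Sum>x'\<in>A. P x x')"

primrec kernel_power :: "('x::finite \<Rightarrow> 'x \<Rightarrow> real) \<Rightarrow> nat \<Rightarrow> 'x \<Rightarrow> 'x \<Rightarrow> real" where
  "kernel_power P 0 = (\<lambda>x y. of_bool (x = y))"
| "kernel_power P (Suc t) = (\<lambda>x y. \<Sum>z\<in>UNIV. kernel_power P t x z * P z y)"

definition is_stationary :: "('x::finite \<Rightarrow> 'x \<Rightarrow> real) \<Rightarrow> ('x \<Rightarrow> real) \<Rightarrow> bool" where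
  "is_stationary P \<mu> \<longleftrightarrow>
     (\<forall>x. 0 \<le> \<mu> x) \<and> (\<Sum>x\<in>UNIV. \<mu> x) = 1 \<and> (\<forall>y. (\<Sum>x\<in>UNIV. \<mu> x * P x y) = \<mu> y)"

text \<open>Meaningful when \<open>P\<close> has exactly one stationary distribution, as Glauber kernels do.\<close>

definition stationary_distribution :: "('x::finite \<Rightarrow> 'x \<Rightarrow> real) \<Rightarrow> 'x \<Rightarrow> real" where
  "stationary_distribution P = (THE \<mu>. is_stationary P \<mu>)"

definition tv_dist :: "('x::finite \<Rightarrow> real) \<Rightarrow> ('x \<Rightarrow> real) \<Rightarrow> real" where
  "tv_dist \<nu> \<nu>' = 1 / 2 * (\<Sum>z\<in>UNIV. \<bar>\<nu> z - \<nu>' z\<bar>)"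

text \<open>
  \<open>LEAST\<close> is a genuine minimum only if the set of times is nonempty, which for Glauber kernels and
  \<open>\<epsilon> > 0\<close> is convergence to stationarity.
\<close>

definition mixing_time :: "('x::finite \<Rightarrow> 'x \<Rightarrow> real) \<Rightarrow> real \<Rightarrow> nat" where
  "mixing_time P \<epsilon> =
     (LEAST t. (MAX x\<in>UNIV. tv_dist (kernel_power P t x) (stationary_distribution P)) \<le> \<epsilon>)"

definition conductance :: "('x::finite \<Rightarrow> 'x \<Rightarrow> real) \<Rightarrow> 'x set \<Rightarrow> real" where
  "conductance P B =
     (\<Sum>x\<in>B. stationary_distribution P x * kernel_prob P x (- B)) /
     (\<Sum>x\<in>B. stationary_distribution P x)"

definition score_maximizer ::
    "('n, 'v) scores \<Rightarrow> ('n \<Rightarrow> ('n \<rightharpoonup> 'v) \<Rightarrow> 'v) \<Rightarrow> bool" where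
  "score_maximizer s m \<longleftrightarrow>
     (\<forall>i x. is_arg_max (\<lambda>a. s i a (remove_site i x)) (\<lambda>a. True) (m i (remove_site i x)))"

definition uniform_local_margin ::
    "('n, 'v) scores \<Rightarrow> ('n \<Rightarrow> ('n \<rightharpoonup> 'v) \<Rightarrow> 'v) \<Rightarrow> ('n \<Rightarrow> 'v) set \<Rightarrow> real \<Rightarrow> bool" where
  "uniform_local_margin s m B \<Delta> \<longleftrightarrow>
     (\<forall>x\<in>B. \<forall>i. (\<exists>a. x(i := a) \<notin> B) \<longrightarrow>
        x i = m i (remove_site i x) \<and>
        (\<forall>a. a \<noteq> x i \<and> x(i := a) \<notin> B \<longrightarrow>
           s i (x i) (remove_site i x) - s i a (remove_site i x) \<ge> \<Delta>))"

end

theory Submission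
  imports Defs
begin

text \<open>
  A state of \<open>B\<close> can leave \<open>B\<close> in one step only by resampling some site to a symbol whose score is
  at least \<open>\<Delta>\<close> below the current one, so each such symbol has conditional probability at most
  \<open>exp (- \<Delta> / \<tau>)\<close>. Since this bounds the exit probability \<open>q\<close> from \<^emph>\<open>every\<close> state of \<open>B\<close>, a chain
  started anywhere in \<open>B\<close> is outside \<open>B\<close> at time \<open>t\<close> with probability at most \<open>t q\<close>, whereas mixing
  requires this probability to be at least \<open>1/2 - 1/4\<close>. The stationary distribution is unique and is
  approached because all \<open>n\<close>-step transition probabilities are positive, so that the oscillation of
  \<open>x \<mapsto> P\<^sup>t x y\<close> over the starting state tends to zero.
\<close>

section \<open>Convergence of finite Markov chains\<close>

definition stochastic :: "('x::finite \<Rightarrow> 'x \<Rightarrow> real) \<Rightarrow> bool" where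
  "stochastic P \<longleftrightarrow> (\<forall>x y. 0 \<le> P x y) \<and> (\<forall>x. (\<Sum>y\<in>UNIV. P x y) = 1)"

lemma stochastic_nonneg: "stochastic P \<Longrightarrow> 0 \<le> P x y"
  and stochastic_sum: "stochastic P \<Longrightarrow> (\<Sum>y\<in>UNIV. P x y) = 1"
  by (auto simp: stochastic_def)

lemma stochastic_kernel_power:
  assumes "stochastic P"
  shows "stochastic (kernel_power P t)"
proof (induction t)
  case 0
  show ?case by (simp add: stochastic_def of_bool_def)
next
  case (Suc t)
  have "(\<Sum>y\<in>UNIV. \<Sum>z\<in>UNIV. kernel_power P t x z * P z y) = 1" for x
    by (subst sum.swap)
      (simp add: sum_distrib_left[symmetric] stochastic_sum[OF assms] stochastic_sum[OF Suc])
  then show ?case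
    using stochastic_nonneg[OF assms] stochastic_nonneg[OF Suc]
    by (auto simp: stochastic_def intro!: sum_nonneg mult_nonneg_nonneg)
qed

lemma kernel_power_add:
  "kernel_power P (s + t) x y = (\<Sum>z\<in>UNIV. kernel_power P s x z * kernel_power P t z y)"
proof (induction t arbitrary: y)
  case 0
  show ?case by (simp add: of_bool_def if_distrib cong: if_cong)
next
  case (Suc t)
  have "kernel_power P (s + Suc t) x y
      = (\<Sum>w\<in>UNIV. \<Sum>z\<in>UNIV. kernel_power P s x z * kernel_power P t z w * P w y)"
    by (simp add: Suc sum_distrib_right)
  also have "\<dots> = (\<Sum>z\<in>UNIV. kernel_power P s x z * kernel_power P (Suc t) z y)"
    by (subst sum.swap) (simp add: sum_distrib_left mult.assoc)
  finally show ?case .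
qed

lemma stationary_kernel_power:
  assumes "is_stationary P \<mu>"
  shows "(\<Sum>x\<in>UNIV. \<mu> x * kernel_power P t x y) = \<mu> y"
proof (induction t arbitrary: y)
  case 0
  show ?case by (simp add: of_bool_def if_distrib cong: if_cong)
next
  case (Suc t)
  have "(\<Sum>x\<in>UNIV. \<mu> x * kernel_power P (Suc t) x y)
      = (\<Sum>z\<in>UNIV. (\<Sum>x\<in>UNIV. \<mu> x * kernel_power P t x z) * P z y)"
    unfolding kernel_power.simps sum_distrib_left sum_distrib_right mult.assoc
    by (rule sum.swap)
  also have "\<dots> = \<mu> y"
    using assms by (simp add: Suc is_stationary_def)
  finally show ?case .
qed

lemma average_ge:
  assumes "stochastic P" and "\<And>z. c \<le> f z"
  shows "c \<le> (\<Sum>z\<in>UNIV. P x z * f z)"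
proof -
  have "c = (\<Sum>z\<in>UNIV. P x z * c)"
    using stochastic_sum[OF assms(1)] by (simp add: sum_distrib_right[symmetric])
  also have "\<dots> \<le> (\<Sum>z\<in>UNIV. P x z * f z)"
    by (intro sum_mono mult_left_mono assms(2) stochastic_nonneg[OF assms(1)])
  finally show ?thesis .
qed

text \<open>The terms \<open>P x z * (C - f z)\<close> are nonnegative, so their sum is at least the
  single term at \<open>w\<close>. Weight at \<open>w\<close> thus pulls the average below the bound
  \<open>C\<close>.\<close>

lemma average_le:
  assumes "stochastic P" and "\<And>z. f z \<le> C" and "\<delta> \<le> P x w"
  shows "(\<Sum>z\<in>UNIV. P x z * f z) \<le> C - \<delta> * (C - f w)"
proof -
  have "\<delta> * (C - f w) \<le> P x w * (C - f w)"
    using assms(2)[of w] assms(3) by (intro mult_right_mono) auto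
  also have "\<dots> \<le> (\<Sum>z\<in>UNIV. P x z * (C - f z))"
    by (rule member_le_sum) (auto simp: assms(2) stochastic_nonneg[OF assms(1)])
  also have "\<dots> = C - (\<Sum>z\<in>UNIV. P x z * f z)"
    by (simp add: right_diff_distrib sum_subtractf sum_distrib_right[symmetric]
        stochastic_sum[OF assms(1)])
  finally show ?thesis by simp
qed

text \<open>Doeblin's argument: each step averages the column \<open>y\<close> over its rows, so its
  maximum \<open>M\<close> falls and its minimum \<open>m\<close> rises. The lower bound \<delta>
  shrinks their gap by the factor \<open>1 - \<delta>\<close> every \<open>N\<close> steps, which
  squeezes all rows to one limit.\<close>

lemma kernel_power_column_converges:
  fixes P :: "'x::finite \<Rightarrow> 'x \<Rightarrow> real"
  assumes P: "stochastic P" and "0 < \<delta>" and \<delta>: "\<And>x y. \<delta> \<le> kernel_power P N x y"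
  shows "\<exists>L. \<forall>x. (\<lambda>t. kernel_power P t x y) \<longlonglongrightarrow> L"
proof -
  define M where "M t = (MAX x. kernel_power P t x y)" for t
  define m where "m t = (MIN x. kernel_power P t x y)" for t
  have le_M: "kernel_power P t x y \<le> M t" and m_le: "m t \<le> kernel_power P t x y" for t x
    by (simp_all add: M_def m_def)
  have m_attained: "\<exists>w. kernel_power P t w y = m t" for t
  proof -
    have "m t \<in> range (\<lambda>x. kernel_power P t x y)"
      unfolding m_def by (rule Min_in) auto
    then show ?thesis by force
  qed
  have add: "kernel_power P (k + t) x y
      = (\<Sum>z\<in>UNIV. kernel_power P k x z * kernel_power P t z y)" for k t x
    by (rule kernel_power_add)
  have m_step: "m t \<le> m (k + t)" for k t
    unfolding m_def[of "k + t"]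
    by (auto simp: add intro!: average_ge[OF stochastic_kernel_power[OF P]] m_le)
  \<comment> \<open>Used twice: \<open>d = 0\<close> yields monotonicity of \<open>M\<close>, while
    \<open>d = \<delta>\<close> with \<open>k = N\<close> yields the contraction. The state
    \<open>w\<close> attains the minimum, so the gain is the full oscillation.\<close>
  have M_step: "M (k + t) \<le> M t - d * (M t - m t)"
    if d: "\<And>x z. d \<le> kernel_power P k x z" for d k t
  proof -
    obtain w where w: "kernel_power P t w y = m t" using m_attained by blast
    have "kernel_power P (k + t) x y \<le> M t - d * (M t - m t)" for x
      using average_le[where f = "\<lambda>z. kernel_power P t z y" and w = w,
          OF stochastic_kernel_power[OF P] le_M d]
      by (simp add: add w)
    then show ?thesis by (simp add: M_def[of "k + t"])
  qed
  have M_decreasing: "M (k + t) \<le> M t" for k t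
    using M_step[of 0 k t] stochastic_nonneg[OF stochastic_kernel_power[OF P]] by simp
  have m_le_M: "m t \<le> M t" for t
    using m_le le_M order_trans by blast
  have M_nonneg: "0 \<le> M t" for t
    using le_M[of t undefined] stochastic_nonneg[OF stochastic_kernel_power[OF P], of t undefined y]
    by linarith
  have "decseq M"
    by (rule decseq_SucI) (use M_decreasing[of 1] in simp)
  then obtain L where L: "M \<longlonglongrightarrow> L"
    using decseq_convergent[of M 0] M_nonneg by blast
  define osc where "osc t = M t - m t" for t
  have osc_nonneg: "0 \<le> osc t" for t
    using m_le_M by (simp add: osc_def)
  have "decseq osc"
    by (rule decseq_SucI) (use M_decreasing[of 1] m_step[of _ 1] in \<open>force simp: osc_def intro: diff_mono\<close>)
  then obtain l where l: "osc \<longlonglongrightarrow> l" "\<And>t. l \<le> osc t"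
    using decseq_convergent[of osc 0] osc_nonneg by blast
  have "osc (t + N) \<le> (1 - \<delta>) * osc t" for t
    using M_step[OF \<delta>, of t] m_step[of t N] by (simp add: osc_def algebra_simps)
  \<comment> \<open>Both sides of the contraction pass to the limit \<open>l\<close> of the
    oscillation; together with \<open>0 \<le> l\<close> and \<open>0 < \<delta>\<close> this forces
    \<open>l = 0\<close>.\<close>
  then have "l \<le> (1 - \<delta>) * l"
    by (intro LIMSEQ_le[OF LIMSEQ_ignore_initial_segment[OF l(1), of N]
          tendsto_mult_left[OF l(1)]]) auto
  then have "\<delta> * l \<le> 0" by (simp add: algebra_simps)
  moreover have "0 \<le> l"
    using LIMSEQ_le_const[OF l(1)] osc_nonneg by blast
  ultimately have "l = 0"
    using \<open>0 < \<delta>\<close> by (simp add: mult_le_0_iff)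
  have m_lim: "m \<longlonglongrightarrow> L"
    using tendsto_diff[OF L l(1)] \<open>l = 0\<close> by (simp add: osc_def)
  have "(\<lambda>t. kernel_power P t x y) \<longlonglongrightarrow> L" for x
    by (rule tendsto_sandwich[OF _ _ m_lim L]) (simp_all add: m_le le_M)
  then show ?thesis by blast
qed

text \<open>The column limits, common to all starting states, form a stationary distribution. Its
  uniqueness is what makes the definite description in \<open>stationary_distribution\<close> denote
  it.\<close>

theorem positive_power_imp_convergence:
  fixes P :: "'x::finite \<Rightarrow> 'x \<Rightarrow> real"
  assumes P: "stochastic P" and pos: "\<And>x y. 0 < kernel_power P N x y"
  shows "is_stationary P (stationary_distribution P)"
    and "(\<lambda>t. kernel_power P t x y) \<longlonglongrightarrow> stationary_distribution P y"
proof -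
  define \<delta> where "\<delta> = Min (range (\<lambda>(x, y). kernel_power P N x y))"
  have "0 < \<delta>" by (auto simp: \<delta>_def pos)
  moreover have "\<delta> \<le> kernel_power P N x y" for x y
    unfolding \<delta>_def by (rule Min_le) (auto intro: rev_image_eqI[of "(x, y)"])
  ultimately have "\<forall>y. \<exists>L. \<forall>x. (\<lambda>t. kernel_power P t x y) \<longlonglongrightarrow> L"
    using kernel_power_column_converges[OF P] by blast
  then obtain \<pi> where \<pi>: "\<And>x y. (\<lambda>t. kernel_power P t x y) \<longlonglongrightarrow> \<pi> y"
    by metis
  have "is_stationary P \<pi>"
    unfolding is_stationary_def
  proof (intro conjI allI)
    fix y
    show "0 \<le> \<pi> y"
      using LIMSEQ_le_const[OF \<pi>] stochastic_nonneg[OF stochastic_kernel_power[OF P]] by blast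
    have "(\<lambda>t. \<Sum>z\<in>UNIV. kernel_power P t undefined z * P z y) \<longlonglongrightarrow> (\<Sum>z\<in>UNIV. \<pi> z * P z y)"
      by (intro tendsto_intros \<pi>)
    then show "(\<Sum>z\<in>UNIV. \<pi> z * P z y) = \<pi> y"
      using LIMSEQ_Suc[OF \<pi>[of undefined y]] by (auto intro: LIMSEQ_unique)
  next
    have "(\<lambda>t. \<Sum>z\<in>UNIV. kernel_power P t undefined z) \<longlonglongrightarrow> (\<Sum>z\<in>UNIV. \<pi> z)"
      by (intro tendsto_intros \<pi>)
    then show "(\<Sum>z\<in>UNIV. \<pi> z) = 1"
      by (simp add: stochastic_sum[OF stochastic_kernel_power[OF P]] LIMSEQ_const_iff)
  qed
  moreover have "\<mu> = \<pi>" if \<mu>: "is_stationary P \<mu>" for \<mu>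
  proof
    fix y
    \<comment> \<open>Started from \<mu>, the chain has law \<mu> at every time, so this sequence is
      constantly \<open>\<mu> y\<close>; its limit is \<open>\<pi> y\<close> because \<mu> has mass
      1.\<close>
    have "(\<lambda>t. \<Sum>x\<in>UNIV. \<mu> x * kernel_power P t x y) \<longlonglongrightarrow> (\<Sum>x\<in>UNIV. \<mu> x * \<pi> y)"
      by (intro tendsto_intros \<pi>)
    then show "\<mu> y = \<pi> y"
      using \<mu> by (simp add: stationary_kernel_power LIMSEQ_const_iff sum_distrib_right[symmetric]
          is_stationary_def)
  qed
  ultimately have "stationary_distribution P = \<pi>"
    unfolding stationary_distribution_def by (rule the_equality)
  with \<open>is_stationary P \<pi>\<close> \<pi> show "is_stationary P (stationary_distribution P)"
    and "(\<lambda>t. kernel_power P t x y) \<longlonglongrightarrow> stationary_distribution P y"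
    by simp_all
qed

text \<open>Convergence provides a time with distance at most \<epsilon>, so the
  \<open>LEAST\<close> in \<open>mixing_time\<close> is attained. Finiteness of the state space
  makes one time serve all starting states.\<close>

lemma tv_dist_mixing_time_le:
  fixes P :: "'x::finite \<Rightarrow> 'x \<Rightarrow> real"
  assumes lim: "\<And>x y. (\<lambda>t. kernel_power P t x y) \<longlonglongrightarrow> stationary_distribution P y"
    and "0 < \<epsilon>"
  shows "tv_dist (kernel_power P (mixing_time P \<epsilon>) x) (stationary_distribution P) \<le> \<epsilon>"
proof -
  define d where "d t x = tv_dist (kernel_power P t x) (stationary_distribution P)" for t x
  have "(\<lambda>t. d t x) \<longlonglongrightarrow>
      1 / 2 * (\<Sum>z\<in>UNIV. \<bar>stationary_distribution P z - stationary_distribution P z\<bar>)" for x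
    unfolding d_def tv_dist_def by (intro tendsto_intros lim)
  then have "(\<lambda>t. d t x) \<longlonglongrightarrow> 0" for x by simp
  then have "\<forall>\<^sub>F t in sequentially. \<forall>x. d t x < \<epsilon>"
    by (intro eventually_all_finite) (use \<open>0 < \<epsilon>\<close> in \<open>auto dest: order_tendstoD(2)\<close>)
  then obtain t where "\<forall>x. d t x < \<epsilon>"
    by (auto simp: eventually_sequentially)
  then have "(MAX x. d t x) \<le> \<epsilon>" by (auto intro: less_imp_le)
  then have "(MAX x. d (mixing_time P \<epsilon>) x) \<le> \<epsilon>"
    unfolding mixing_time_def d_def by (rule LeastI)
  then show ?thesis by (simp add: d_def)
qed

section \<open>Escape from a set\<close>

text \<open>With equal masses, the excess of \<open>\<nu>'\<close> on \<open>A\<close> equals its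
  deficit on the complement; each is bounded by the absolute differences there, whence the factor
  1/2.\<close>

lemma diff_sum_le_tv_dist:
  assumes "(\<Sum>z\<in>UNIV. \<nu> z) = (\<Sum>z\<in>UNIV. \<nu>' z)"
  shows "(\<Sum>z\<in>A. \<nu>' z) - (\<Sum>z\<in>A. \<nu> z) \<le> tv_dist \<nu> \<nu>'"
proof -
  define h where "h z = \<nu>' z - \<nu> z" for z
  have split: "(\<Sum>z\<in>UNIV. g z) = (\<Sum>z\<in>A. g z) + (\<Sum>z\<in>-A. g z)" for g :: "'a \<Rightarrow> real"
    using sum.union_disjoint[of A "- A" g] by simp
  have "(\<Sum>z\<in>A. h z) + (\<Sum>z\<in>-A. h z) = 0"
    using assms split[of h] by (simp add: h_def sum_subtractf)
  moreover have "(\<Sum>z\<in>A. h z) \<le> (\<Sum>z\<in>A. \<bar>h z\<bar>)" "- (\<Sum>z\<in>-A. h z) \<le> (\<Sum>z\<in>-A. \<bar>h z\<bar>)"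
    by (auto simp: sum_negf[symmetric] intro!: sum_mono)
  ultimately have "(\<Sum>z\<in>A. h z) \<le> 1 / 2 * (\<Sum>z\<in>UNIV. \<bar>h z\<bar>)"
    by (simp add: split)
  then show ?thesis
    by (simp add: h_def tv_dist_def sum_subtractf abs_minus_commute)
qed

text \<open>A chain outside \<open>B\<close> at time \<open>t + 1\<close> was either outside already
  or has just left, the latter with probability at most \<open>q\<close>. Returns to
  \<open>B\<close> only help the bound.\<close>

lemma kernel_power_exit_le:
  assumes P: "stochastic P" and q: "\<And>x. x \<in> B \<Longrightarrow> kernel_prob P x (- B) \<le> q" and "x \<in> B"
  shows "kernel_prob (kernel_power P t) x (- B) \<le> real t * q"
proof (induction t)
  case 0
  show ?case using \<open>x \<in> B\<close> by (auto simp: kernel_prob_def intro!: sum_nonpos)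
next
  case (Suc t)
  let ?p = "kernel_power P t x"
  have p: "stochastic (kernel_power P t)" by (rule stochastic_kernel_power[OF P])
  have "0 \<le> q"
    using q[OF \<open>x \<in> B\<close>] stochastic_nonneg[OF P] sum_nonneg[of "- B" "P x"]
    by (fastforce simp: kernel_prob_def)
  have exit_le_1: "kernel_prob P z (- B) \<le> 1" for z
    unfolding kernel_prob_def
    by (subst stochastic_sum[OF P, of z, symmetric], rule sum_mono2)
      (auto simp: stochastic_nonneg[OF P])
  have "kernel_prob (kernel_power P (Suc t)) x (- B) = (\<Sum>z\<in>UNIV. ?p z * kernel_prob P z (- B))"
    unfolding kernel_prob_def kernel_power.simps sum_distrib_left by (rule sum.swap)
  also have "\<dots> \<le> (\<Sum>z\<in>UNIV. ?p z * q + of_bool (z \<in> - B) * ?p z)"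
  proof (rule sum_mono)
    \<comment> \<open>One inequality for both cases: \<open>q\<close> bounds the exit from inside
      \<open>B\<close>, and the trivial bound 1 serves outside.\<close>
    fix z
    have "kernel_prob P z (- B) \<le> q + of_bool (z \<in> - B)"
      using q[of z] exit_le_1[of z] \<open>0 \<le> q\<close> by (cases "z \<in> B") auto
    from mult_left_mono[OF this stochastic_nonneg[OF p, of x z]]
    show "?p z * kernel_prob P z (- B) \<le> ?p z * q + of_bool (z \<in> - B) * ?p z"
      by (simp add: algebra_simps)
  qed
  also have "\<dots> = q + (\<Sum>z\<in>UNIV. of_bool (z \<in> - B) * ?p z)"
    by (simp add: sum.distrib sum_distrib_right[symmetric] stochastic_sum[OF p])
  also have "(\<Sum>z\<in>UNIV. of_bool (z \<in> - B) * ?p z) = kernel_prob (kernel_power P t) x (- B)"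
    unfolding kernel_prob_def by (rule sum.mono_neutral_cong_right) auto
  finally show ?case using Suc by (simp add: algebra_simps)
qed

section \<open>The Glauber kernel\<close>

lemma remove_site_eq_iff: "remove_site i x = remove_site i y \<longleftrightarrow> y = x(i := y i)"
  by (auto simp: remove_site_def fun_eq_iff split: if_splits)

text \<open>The configurations sharing the context of \<open>x\<close> at \<open>i\<close> are
  exactly \<open>x(i := a)\<close>, so they are indexed by the new symbol.\<close>

lemma sum_same_context:
  fixes x :: "'n::finite \<Rightarrow> 'v::finite" and f :: "'v \<Rightarrow> real"
  shows "(\<Sum>x'\<in>A. of_bool (remove_site i x = remove_site i x') * f (x' i))
    = (\<Sum>a | x(i := a) \<in> A. f a)"
proof -
  have "(\<Sum>x'\<in>A. of_bool (remove_site i x = remove_site i x') * f (x' i))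
      = (\<Sum>x'\<in>{x'\<in>A. remove_site i x = remove_site i x'}. f (x' i))"
    by (rule sum.mono_neutral_cong_right) auto
  also have "\<dots> = (\<Sum>a | x(i := a) \<in> A. f a)"
    by (rule sum.reindex_bij_witness[of _ "\<lambda>a. x(i := a)" "\<lambda>x'. x' i"])
      (auto simp: remove_site_eq_iff)
  finally show ?thesis .
qed

lemma glauber_kernel_prob:
  fixes x :: "'n::finite \<Rightarrow> 'v::finite"
  shows "kernel_prob (glauber_kernel s \<tau>) x A =
    1 / real CARD('n) *
      (\<Sum>i\<in>UNIV. \<Sum>a | x(i := a) \<in> A. local_conditional s \<tau> i a (remove_site i x))"
  unfolding kernel_prob_def glauber_kernel_def sum_distrib_left[symmetric]
  by (subst sum.swap)
    (simp only: sum_same_context[where f = "\<lambda>a. local_conditional s \<tau> i a (remove_site i x)" for i])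

lemma sum_exp_pos: "0 < (\<Sum>b\<in>UNIV. exp (f (b::'v::finite)) :: real)"
  by (rule sum_pos) auto

lemma local_conditional_pos: "0 < local_conditional s \<tau> i a c"
  by (simp add: local_conditional_def sum_exp_pos)

lemma sum_local_conditional: "(\<Sum>a\<in>UNIV. local_conditional s \<tau> i a c) = 1"
  using sum_exp_pos[of "\<lambda>b. s i b c / \<tau>"]
  by (simp add: local_conditional_def sum_divide_distrib[symmetric])

text \<open>The normalizing sum contains the term of \<open>b\<close>; keeping only that term leaves
  the exponential of a score difference.\<close>

lemma local_conditional_le:
  assumes "\<tau> > 0" and "s i b c - s i a c \<ge> \<Delta>"
  shows "local_conditional s \<tau> i a c \<le> exp (- \<Delta> / \<tau>)"
proof -
  have "local_conditional s \<tau> i a c \<le> exp (s i a c / \<tau>) / exp (s i b c / \<tau>)"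
    unfolding local_conditional_def
    by (intro divide_left_mono member_le_sum mult_pos_pos sum_exp_pos) auto
  also have "\<dots> = exp ((s i a c - s i b c) / \<tau>)"
    by (simp add: exp_diff diff_divide_distrib)
  also have "\<dots> \<le> exp (- \<Delta> / \<tau>)"
    using assms by (simp only: exp_le_cancel_iff) (intro divide_right_mono, auto)
  finally show ?thesis .
qed

lemma stochastic_glauber_kernel: "stochastic (glauber_kernel s \<tau>)"
  unfolding stochastic_def
proof (intro conjI allI)
  fix x y :: "'a \<Rightarrow> 'b"
  show "0 \<le> glauber_kernel s \<tau> x y"
    unfolding glauber_kernel_def
    by (intro mult_nonneg_nonneg sum_nonneg) (auto simp: local_conditional_pos less_imp_le)
  show "(\<Sum>y\<in>UNIV. glauber_kernel s \<tau> x y) = 1"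
    using glauber_kernel_prob[of s \<tau> x UNIV] by (simp add: sum_local_conditional kernel_prob_def)
qed

lemma glauber_kernel_pos:
  assumes "remove_site i x = remove_site i y"
  shows "0 < glauber_kernel s \<tau> x y"
proof -
  have "0 < (\<Sum>i\<in>UNIV. of_bool (remove_site i x = remove_site i y) *
      local_conditional s \<tau> i (y i) (remove_site i x))"
    by (rule sum_pos2[of _ i]) (auto simp: assms local_conditional_pos less_imp_le)
  then show ?thesis by (simp add: glauber_kernel_def)
qed

text \<open>The sites of \<open>A\<close> are corrected one at a time. An update may also keep its
  symbol, so \<open>A\<close> may contain sites where \<open>x\<close> and \<open>y\<close> agree;
  \<open>A = UNIV\<close> then gives one exponent for all pairs of states.\<close>

lemma glauber_kernel_power_pos:
  assumes "\<And>i. i \<notin> A \<Longrightarrow> x i = y i"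
  shows "0 < kernel_power (glauber_kernel s \<tau>) (card A) x y"
  using finite[of A] assms
proof (induction A arbitrary: y rule: finite_induct)
  case empty
  then have "x = y" by auto
  then show ?case by simp
next
  case (insert i A)
  let ?z = "y(i := x i)"
  have "0 < kernel_power (glauber_kernel s \<tau>) (card A) x ?z"
    by (rule insert.IH) (use insert.prems in auto)
  moreover have "0 < glauber_kernel s \<tau> ?z y"
    by (rule glauber_kernel_pos[of i]) (simp add: remove_site_eq_iff)
  ultimately have "0 < (\<Sum>z\<in>UNIV. kernel_power (glauber_kernel s \<tau>) (card A) x z *
      glauber_kernel s \<tau> z y)"
    by (intro sum_pos2[of _ ?z] mult_pos_pos mult_nonneg_nonneg
        stochastic_nonneg[OF stochastic_glauber_kernel]
        stochastic_nonneg[OF stochastic_kernel_power[OF stochastic_glauber_kernel]]) auto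
  then show ?case using insert.hyps by simp
qed

lemma glauber_exit_le:
  fixes B :: "('n::finite \<Rightarrow> 'v::finite) set"
  assumes "\<tau> > 0" and "uniform_local_margin s m B \<Delta>" and "x \<in> B"
  shows "kernel_prob (glauber_kernel s \<tau>) x (- B) \<le> real CARD('v) * exp (- \<Delta> / \<tau>)"
proof -
  have "(\<Sum>a | x(i := a) \<in> - B. local_conditional s \<tau> i a (remove_site i x))
      \<le> real CARD('v) * exp (- \<Delta> / \<tau>)" for i
  proof -
    have "local_conditional s \<tau> i a (remove_site i x) \<le> exp (- \<Delta> / \<tau>)"
      if "x(i := a) \<notin> B" for a
    proof -
      \<comment> \<open>Rewriting the current symbol leaves \<open>x\<close> unchanged, hence inside
        \<open>B\<close>; so the margin condition applies to every exiting symbol.\<close>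
      have "a \<noteq> x i" using that \<open>x \<in> B\<close> by auto
      with that assms show ?thesis
        unfolding uniform_local_margin_def by (intro local_conditional_le) blast+
    qed
    then have "(\<Sum>a | x(i := a) \<in> - B. local_conditional s \<tau> i a (remove_site i x))
        \<le> real (card {a. x(i := a) \<in> - B}) * exp (- \<Delta> / \<tau>)"
      by (intro sum_bounded_above) auto
    also have "\<dots> \<le> real CARD('v) * exp (- \<Delta> / \<tau>)"
      by (intro mult_right_mono) (auto intro: card_mono)
    finally show ?thesis .
  qed
  \<comment> \<open>The same bound holds at each site, so the number of sites cancels against the
    uniform choice of site.\<close>
  then have "(\<Sum>i\<in>UNIV. \<Sum>a | x(i := a) \<in> - B. local_conditional s \<tau> i a (remove_site i x))
      \<le> real CARD('n) * (real CARD('v) * exp (- \<Delta> / \<tau>))"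
    by (intro sum_bounded_above) auto
  then show ?thesis
    unfolding glauber_kernel_prob by (simp add: field_simps)
qed

theorem theorem8:
  fixes s :: "('n::finite, 'v::finite) scores"
    and m :: "'n \<Rightarrow> ('n \<rightharpoonup> 'v) \<Rightarrow> 'v"
    and B :: "('n \<Rightarrow> 'v) set"
    and \<tau> \<Delta> :: real
  assumes "\<tau> > 0"
    and "score_maximizer s m"
    and "B \<noteq> {}"
    and "\<Delta> > 0"
    and "uniform_local_margin s m B \<Delta>"
  shows "(\<forall>x\<in>B. kernel_prob (glauber_kernel s \<tau>) x (- B) \<le> real CARD('v) * exp (- \<Delta> / \<tau>)) \<and>
    conductance (glauber_kernel s \<tau>) B \<le> real CARD('v) * exp (- \<Delta> / \<tau>) \<and>
    ((\<Sum>x\<in>B. stationary_distribution (glauber_kernel s \<tau>) x) \<le> 1 / 2 \<longrightarrow>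
      real (mixing_time (glauber_kernel s \<tau>) (1 / 4)) \<ge> 1 / (4 * real CARD('v)) * exp (\<Delta> / \<tau>))"
proof (intro conjI impI)
  let ?P = "glauber_kernel s \<tau>"
  let ?\<mu> = "stationary_distribution ?P"
  define q where "q = real CARD('v) * exp (- \<Delta> / \<tau>)"
  have exit: "kernel_prob ?P x (- B) \<le> q" if "x \<in> B" for x
    unfolding q_def using that by (rule glauber_exit_le[OF assms(1,5)])
  then show "\<forall>x\<in>B. kernel_prob ?P x (- B) \<le> real CARD('v) * exp (- \<Delta> / \<tau>)"
    by (simp add: q_def)
  have "0 < q" by (simp add: q_def)
  have pos: "0 < kernel_power ?P CARD('n) x y" for x y
    using glauber_kernel_power_pos[of UNIV] by blast
  note stationary = positive_power_imp_convergence(1)[OF stochastic_glauber_kernel pos]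
  note lim = positive_power_imp_convergence(2)[OF stochastic_glauber_kernel pos]
  have \<mu>_nonneg: "0 \<le> ?\<mu> x" for x
    using stationary by (simp add: is_stationary_def)
  have \<mu>_sum: "(\<Sum>x\<in>UNIV. ?\<mu> x) = 1"
    using stationary by (simp add: is_stationary_def)

  have "(\<Sum>x\<in>B. ?\<mu> x * kernel_prob ?P x (- B)) \<le> q * (\<Sum>x\<in>B. ?\<mu> x)"
    unfolding sum_distrib_left
    by (intro sum_mono) (metis exit \<mu>_nonneg mult.commute mult_left_mono)
  \<comment> \<open>The conductance is a weighted average of exit probabilities. If the mass of
    \<open>B\<close> is 0, division by zero gives the value 0, which is below
    \<open>q\<close>.\<close>
  then have "conductance ?P B \<le> q"
    unfolding conductance_def using \<open>0 < q\<close> sum_nonneg[of B ?\<mu>] \<mu>_nonneg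
    by (cases "(\<Sum>x\<in>B. ?\<mu> x) = 0") (auto simp: divide_le_eq less_le)
  then show "conductance ?P B \<le> real CARD('v) * exp (- \<Delta> / \<tau>)"
    by (simp add: q_def)

  let ?t = "mixing_time ?P (1 / 4)"
  assume half: "(\<Sum>x\<in>B. ?\<mu> x) \<le> 1 / 2"
  obtain x where "x \<in> B" using assms(3) by blast
  have "(\<Sum>z\<in>-B. ?\<mu> z) \<ge> 1 / 2"
    using half \<mu>_sum sum.union_disjoint[of B "- B" ?\<mu>] by simp
  \<comment> \<open>At the mixing time the mass outside \<open>B\<close> is within 1/4 of its
    stationary value, so at least 1/4 has escaped; linear growth of the escape at rate
    \<open>q\<close> then bounds the time from below.\<close>
  moreover have "(\<Sum>z\<in>-B. ?\<mu> z) - kernel_prob (kernel_power ?P ?t) x (- B) \<le> 1 / 4"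
    unfolding kernel_prob_def
    by (rule order_trans[OF diff_sum_le_tv_dist tv_dist_mixing_time_le[OF lim]])
      (simp_all add: \<mu>_sum stochastic_sum[OF stochastic_kernel_power[OF stochastic_glauber_kernel]])
  moreover have "kernel_prob (kernel_power ?P ?t) x (- B) \<le> real ?t * q"
    by (rule kernel_power_exit_le[OF stochastic_glauber_kernel exit \<open>x \<in> B\<close>])
  ultimately have "1 / 4 \<le> real ?t * q" by linarith
  then have "1 / (4 * q) \<le> real ?t"
    using \<open>0 < q\<close> by (simp add: field_simps)
  moreover have "1 / (4 * q) = 1 / (4 * real CARD('v)) * exp (\<Delta> / \<tau>)"
    by (simp add: q_def exp_minus field_simps)
  ultimately show "real ?t \<ge> 1 / (4 * real CARD('v)) * exp (\<Delta> / \<tau>)" by simp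
qed

end
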